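(* Let $\langle\mathbb A,\alpha\rangle$, $\langle\mathbb B,\beta\rangle$ be countable incompressible dynamical systems, $\iota$ an embedding of $\langle\mathbb A,\alpha\rangle$ into $\langle\mathbb B,\beta\rangle$, and $\eta$ an embedding of $\langle\mathbb A,\alpha\rangle$ into $\langle\mathcal P(\omega)/\mathrm{Fin},\sigma\rangle$. There exists an embedding $\bar\eta$ of $\langle\mathbb B,\beta\rangle$ into $\langle\mathcal P(\omega)/\mathrm{Fin},\sigma\rangle$ with $\bar\eta\circ\iota=\eta$ if and only if the following condition $(\dagger)$ holds: for every partition $\mathcal A$ of $\mathbb A$ and every partition $\mathcal B$ of $\mathbb B$ refining $\iota[\mathcal A]$, there are a partition $\mathcal C$ of $\mathcal P(\omega)/\mathrm{Fin}$ refining $\eta[\mathcal A]$ and a digraph isomorphism $\tilde\eta$ from $\langle\mathcal B,\to_\beta\rangle$ to $\langle\mathcal C,\to_\sigma\rangle$ such that $\tilde\eta(\iota(a))=\eta(a)$ for all $a\in\mathcal A$, where $\tilde\eta(\iota(a))$ means $\bigvee\{\tilde\eta(b):b\in\mathcal B,\ b\le\iota(a)\}$.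
   Context: $\mathcal P(\omega)/\mathrm{Fin}$ is $\mathcal P(\omega)$ modulo finite sets, $\sigma([A])=[A+1]$ the shift. A dynamical system is a Boolean algebra with an automorphism; an embedding of $\langle\mathbb A,\alpha\rangle$ into $\langle\mathbb B,\beta\rangle$ is an injective Boolean homomorphism $\eta$ with $\eta\circ\alpha=\beta\circ\eta$; incompressible means no $x\notin\{\mathbf 0,\mathbf 1\}$ has $\alpha(x)\le x$. A partition of a Boolean algebra is a finite set of nonzero pairwise disjoint elements with join $\mathbf 1$; a partition $\mathcal V$ refines a partition (or finite set) $\mathcal U$ if each member of $\mathcal V$ lies below some member of $\mathcal U$. For a partition $\mathcal U$ of a system with automorphism $\gamma$, the digraph $\langle\mathcal U,\to_\gamma\rangle$ has $x\to_\gamma y$ iff $\gamma(x)\wedge y\ne\mathbf 0$. *)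

theory Defs
  imports Main "HOL-Library.Countable_Set"
begin

section \<open>Boolean algebras and dynamical systems\<close>

text \<open>
  An arbitrary Boolean algebra is rendered as a type of class \<open>boolean_algebra\<close>. The class
  also admits the one-element algebra.
\<close>

definition boolean_hom :: "('a::boolean_algebra \<Rightarrow> 'b::boolean_algebra) \<Rightarrow> bool" where
  "boolean_hom h \<longleftrightarrow>
     h bot = bot \<and> h top = top \<and>
     (\<forall>x y. h (inf x y) = inf (h x) (h y)) \<and>
     (\<forall>x y. h (sup x y) = sup (h x) (h y)) \<and>
     (\<forall>x. h (- x) = - h x)"

definition dynamical_system :: "('a::boolean_algebra \<Rightarrow> 'a) \<Rightarrow> bool" where
  "dynamical_system \<alpha> \<longleftrightarrow> boolean_hom \<alpha> \<and> bij \<alpha>"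

definition incompressible :: "('a::boolean_algebra \<Rightarrow> 'a) \<Rightarrow> bool" where
  "incompressible \<alpha> \<longleftrightarrow> (\<nexists>x. x \<notin> {bot, top} \<and> \<alpha> x \<le> x)"

definition embedding ::
  "('a::boolean_algebra \<Rightarrow> 'a) \<Rightarrow> ('b::boolean_algebra \<Rightarrow> 'b) \<Rightarrow> ('a \<Rightarrow> 'b) \<Rightarrow> bool" where
  "embedding \<alpha> \<beta> \<eta> \<longleftrightarrow> boolean_hom \<eta> \<and> inj \<eta> \<and> \<eta> \<circ> \<alpha> = \<beta> \<circ> \<eta>"

section \<open>Partitions and their digraphs\<close>

text \<open>
  The join of a finite set. \<open>Sup_fin\<close> is unspecified on the empty set; inserting the
  bottom element makes the empty join \<open>bot\<close> and changes no other finite join.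
\<close>

definition finite_join :: "'a::boolean_algebra set \<Rightarrow> 'a" where
  "finite_join U = Sup_fin (insert bot U)"

definition is_partition :: "'a::boolean_algebra set \<Rightarrow> bool" where
  "is_partition U \<longleftrightarrow>
     finite U \<and> bot \<notin> U \<and> pairwise (\<lambda>x y. inf x y = bot) U \<and> finite_join U = top"

definition refines :: "'a::boolean_algebra set \<Rightarrow> 'a set \<Rightarrow> bool" where
  "refines V U \<longleftrightarrow> (\<forall>v\<in>V. \<exists>u\<in>U. v \<le> u)"

definition arrow :: "('a::boolean_algebra \<Rightarrow> 'a) \<Rightarrow> 'a \<Rightarrow> 'a \<Rightarrow> bool" where
  "arrow \<gamma> x y \<longleftrightarrow> inf (\<gamma> x) y \<noteq> bot"

definition digraph_iso_betw ::
  "'a set \<Rightarrow> ('a \<Rightarrow> 'a \<Rightarrow> bool) \<Rightarrow> 'b set \<Rightarrow> ('b \<Rightarrow> 'b \<Rightarrow> bool) \<Rightarrow> ('a \<Rightarrow> 'b) \<Rightarrow> bool" where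
  "digraph_iso_betw U R V S f \<longleftrightarrow>
     bij_betw f U V \<and> (\<forall>x\<in>U. \<forall>y\<in>U. R x y \<longleftrightarrow> S (f x) (f y))"

section \<open>The algebra of subsets of \<open>\<omega>\<close> modulo finite sets\<close>

definition eq_mod_fin :: "nat set \<Rightarrow> nat set \<Rightarrow> bool" where
  "eq_mod_fin X Y \<longleftrightarrow> finite ((X - Y) \<union> (Y - X))"

lemma equivp_eq_mod_fin: "equivp eq_mod_fin"
proof (rule equivpI)
  show "reflp eq_mod_fin"
    by (auto simp: reflp_def eq_mod_fin_def)
  show "symp eq_mod_fin"
    by (auto simp: symp_def eq_mod_fin_def)
  show "transp eq_mod_fin"
  proof (rule transpI)
    fix X Y Z assume "eq_mod_fin X Y" "eq_mod_fin Y Z"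
    then have "finite (((X - Y) \<union> (Y - X)) \<union> ((Y - Z) \<union> (Z - Y)))"
      by (simp add: eq_mod_fin_def)
    then show "eq_mod_fin X Z"
      unfolding eq_mod_fin_def by (rule rev_finite_subset) auto
  qed
qed

quotient_type pomega_fin = "nat set" / eq_mod_fin
  by (rule equivp_eq_mod_fin)

instantiation pomega_fin :: boolean_algebra
begin

lift_definition bot_pomega_fin :: pomega_fin is "{}" .

lift_definition top_pomega_fin :: pomega_fin is "UNIV" .

lift_definition inf_pomega_fin :: "pomega_fin \<Rightarrow> pomega_fin \<Rightarrow> pomega_fin" is "(\<inter>)"
proof -
  fix X X' Y Y' assume "eq_mod_fin X X'" "eq_mod_fin Y Y'"
  then have "finite (((X - X') \<union> (X' - X)) \<union> ((Y - Y') \<union> (Y' - Y)))"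
    by (simp add: eq_mod_fin_def)
  then show "eq_mod_fin (X \<inter> Y) (X' \<inter> Y')"
    unfolding eq_mod_fin_def by (rule rev_finite_subset) auto
qed

lift_definition sup_pomega_fin :: "pomega_fin \<Rightarrow> pomega_fin \<Rightarrow> pomega_fin" is "(\<union>)"
proof -
  fix X X' Y Y' assume "eq_mod_fin X X'" "eq_mod_fin Y Y'"
  then have "finite (((X - X') \<union> (X' - X)) \<union> ((Y - Y') \<union> (Y' - Y)))"
    by (simp add: eq_mod_fin_def)
  then show "eq_mod_fin (X \<union> Y) (X' \<union> Y')"
    unfolding eq_mod_fin_def by (rule rev_finite_subset) auto
qed

lift_definition uminus_pomega_fin :: "pomega_fin \<Rightarrow> pomega_fin" is "uminus"
proof -
  fix X X' :: "nat set" assume "eq_mod_fin X X'"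
  then have "finite ((X - X') \<union> (X' - X))"
    by (simp add: eq_mod_fin_def)
  then show "eq_mod_fin (- X) (- X')"
    unfolding eq_mod_fin_def by (rule rev_finite_subset) auto
qed

definition minus_pomega_fin :: "pomega_fin \<Rightarrow> pomega_fin \<Rightarrow> pomega_fin" where
  "minus_pomega_fin x y = inf x (- y)"

lift_definition less_eq_pomega_fin :: "pomega_fin \<Rightarrow> pomega_fin \<Rightarrow> bool"
  is "\<lambda>X Y. finite (X - Y)"
proof -
  fix X X' Y Y' :: "nat set" assume "eq_mod_fin X X'" "eq_mod_fin Y Y'"
  then have fin: "finite (((X - X') \<union> (X' - X)) \<union> ((Y - Y') \<union> (Y' - Y)))" (is "finite ?D")
    by (simp add: eq_mod_fin_def)
  have "finite (X' - Y')" if "finite (X - Y)"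
    by (rule finite_subset[of _ "?D \<union> (X - Y)"]) (use fin that in auto)
  moreover have "finite (X - Y)" if "finite (X' - Y')"
    by (rule finite_subset[of _ "?D \<union> (X' - Y')"]) (use fin that in auto)
  ultimately show "finite (X - Y) = finite (X' - Y')" by blast
qed

definition less_pomega_fin :: "pomega_fin \<Rightarrow> pomega_fin \<Rightarrow> bool" where
  "less_pomega_fin x y \<longleftrightarrow> x \<le> y \<and> \<not> y \<le> x"

instance
proof
  fix x y z :: pomega_fin
  show "x < y \<longleftrightarrow> x \<le> y \<and> \<not> y \<le> x"
    by (rule less_pomega_fin_def)
  show "x \<le> x"
    by transfer simp
  show "x \<le> z" if "x \<le> y" "y \<le> z"
    using that
  proof transfer
    fix X Y Z :: "nat set" assume "finite (X - Y)" "finite (Y - Z)"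
    then have "finite ((X - Y) \<union> (Y - Z))" by simp
    then show "finite (X - Z)" by (rule rev_finite_subset) auto
  qed
  show "x = y" if "x \<le> y" "y \<le> x"
    using that by transfer (simp add: eq_mod_fin_def)
  show "inf x y \<le> x"
    by transfer (simp add: Diff_eq)
  show "inf x y \<le> y"
    by transfer (simp add: Diff_eq Int_assoc)
  show "x \<le> inf y z" if "x \<le> y" "x \<le> z"
    using that by transfer (simp add: Diff_Int)
  show "x \<le> sup x y"
    by transfer (metis Diff_cancel Diff_eq_empty_iff Un_upper1 finite.emptyI)
  show "y \<le> sup x y"
    by transfer (metis Diff_eq_empty_iff Un_upper2 finite.emptyI)
  show "sup y z \<le> x" if "y \<le> x" "z \<le> x"
    using that by transfer (simp add: Un_Diff)
  show "bot \<le> x"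
    by transfer simp
  show "x \<le> top"
    by transfer simp
  show "sup x (inf y z) = inf (sup x y) (sup x z)"
    by transfer (simp add: Un_Int_distrib eq_mod_fin_def)
  show "inf x (- x) = bot"
    by transfer (simp add: eq_mod_fin_def)
  show "sup x (- x) = top"
    by transfer (simp add: eq_mod_fin_def)
  show "x - y = inf x (- y)"
    by (rule minus_pomega_fin_def)
qed

end

lift_definition shift :: "pomega_fin \<Rightarrow> pomega_fin" is "\<lambda>X. Suc ` X"
proof -
  fix X X' assume "eq_mod_fin X X'"
  then have "finite (Suc ` ((X - X') \<union> (X' - X)))"
    by (simp add: eq_mod_fin_def)
  then show "eq_mod_fin (Suc ` X) (Suc ` X')"
    unfolding eq_mod_fin_def by (rule rev_finite_subset) auto
qed

lemma dynamical_system_shift: "dynamical_system shift"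
  unfolding dynamical_system_def boolean_hom_def
proof (intro conjI allI)
  fix x y :: pomega_fin
  show "shift bot = bot"
    by transfer (simp add: eq_mod_fin_def)
  show "shift top = top"
  proof transfer
    have "(Suc ` UNIV - UNIV) \<union> (UNIV - Suc ` UNIV) = {0}"
      using not0_implies_Suc by auto
    then show "eq_mod_fin (Suc ` UNIV) UNIV" by (simp add: eq_mod_fin_def)
  qed
  show "shift (inf x y) = inf (shift x) (shift y)"
    by transfer (simp add: image_Int eq_mod_fin_def)
  show "shift (sup x y) = sup (shift x) (shift y)"
    by transfer (simp add: image_Un eq_mod_fin_def)
  show "shift (- x) = - shift x"
  proof transfer
    fix X :: "nat set"
    have "(Suc ` (- X) - (- Suc ` X)) \<union> ((- Suc ` X) - Suc ` (- X)) \<subseteq> {0}"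
      using not0_implies_Suc by fastforce
    then show "eq_mod_fin (Suc ` (- X)) (- Suc ` X)"
      unfolding eq_mod_fin_def by (rule finite_subset) simp
  qed
  show "bij shift"
  proof (rule bijI)
    show "inj shift"
    proof (rule injI)
      fix x y assume "shift x = shift y"
      then show "x = y"
      proof transfer
        fix X Y assume "eq_mod_fin (Suc ` X) (Suc ` Y)"
        then have "finite (Suc ` ((X - Y) \<union> (Y - X)))"
          unfolding eq_mod_fin_def by (rule rev_finite_subset) auto
        then show "eq_mod_fin X Y"
          unfolding eq_mod_fin_def by (rule finite_imageD) simp
      qed
    qed
    have "\<exists>x. y = shift x" for y
    proof transfer
      fix Y :: "nat set"
      have "(Y - Suc ` (Suc -` Y)) \<union> (Suc ` (Suc -` Y) - Y) \<subseteq> {0}"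
        using not0_implies_Suc by fastforce
      then have "eq_mod_fin Y (Suc ` (Suc -` Y))"
        unfolding eq_mod_fin_def by (rule finite_subset) simp
      then show "\<exists>X. eq_mod_fin Y (Suc ` X)" ..
    qed
    then show "surj shift" by (simp add: surj_def)
  qed
qed

end

theory Submission
  imports Defs "HOL-Library.Diagonal_Subsequence"
begin

text \<open>
  Condition (\<open>\<dagger>\<close>) supplies, for each finite set of elements of the larger algebra, a map into
  \<open>P(\<omega>)/Fin\<close> that is a homomorphism commuting with the shift on that set and agrees with
  \<open>\<eta>\<close> there. After choosing representatives, the value of such a map at time \<open>k\<close> is a
  truth assignment, and the algebraic identities hold at almost all times. Following the \<open>m\<close>-th
  approximation on a long interval and then switching to a later one violates commutation with the
  shift only if the two assignments differ at the switching time. By compactness of Cantor space one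
  can choose a sequence of approximations and switching times at which they agree on more and more
  elements, so the spliced assignment represents an embedding.
\<close>

section \<open>Joins and partitions\<close>

lemma finite_join_le_iff:
  assumes "finite U"
  shows "finite_join U \<le> z \<longleftrightarrow> (\<forall>u\<in>U. u \<le> z)"
  using assms by (simp add: finite_join_def Sup_fin.bounded_iff)

lemma finite_join_empty: "finite_join {} = bot"
  by (simp add: finite_join_def)

lemma finite_join_insert:
  assumes "finite U"
  shows "finite_join (insert u U) = sup u (finite_join U)"
  using assms by (simp add: finite_join_def insert_commute[of bot])

lemma le_finite_join:
  assumes "finite U" "u \<in> U"
  shows "u \<le> finite_join U"
  using finite_join_le_iff[OF assms(1), of "finite_join U"] assms(2) by simp

lemma is_partition_finite: "is_partition U \<Longrightarrow> finite U"
  by (simp add: is_partition_def)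

lemma is_partition_nonbot: "is_partition U \<Longrightarrow> u \<in> U \<Longrightarrow> u \<noteq> bot"
  by (auto simp: is_partition_def)

lemma is_partition_disjoint:
  "is_partition U \<Longrightarrow> u \<in> U \<Longrightarrow> v \<in> U \<Longrightarrow> u \<noteq> v \<Longrightarrow> inf u v = bot"
  by (auto simp: is_partition_def pairwise_def)

lemma is_partition_top_le:
  assumes "is_partition U" "\<And>u. u \<in> U \<Longrightarrow> u \<le> z"
  shows "z = top"
  using assms finite_join_le_iff[of U z] by (simp add: is_partition_def top_unique)

lemma inf_eq_bot_iff_le_compl: "inf x y = bot \<longleftrightarrow> x \<le> - (y::'a::boolean_algebra)"
  using inf_shunt by auto

text \<open>For a partition \<open>U\<close> this says that \<open>x\<close> lies in the finite
  subalgebra whose atoms are the members of \<open>U\<close>, without naming that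
  subalgebra.\<close>

definition decided :: "'a::boolean_algebra set \<Rightarrow> 'a \<Rightarrow> bool" where
  "decided U x \<longleftrightarrow> (\<forall>u\<in>U. u \<le> x \<or> u \<le> - x)"

lemma decided_uminus: "decided U x \<Longrightarrow> decided U (- x)"
  by (auto simp: decided_def)

text \<open>Each member of \<open>U\<close> lies below \<open>- x\<close> or below the join of the
  members under \<open>x\<close>, so these two have supremum \<open>top\<close>.\<close>

lemma join_below_decided:
  assumes "is_partition U" "decided U x"
  shows "finite_join {u \<in> U. u \<le> x} = x"
proof (rule antisym)
  have fin: "finite {u \<in> U. u \<le> x}"
    using assms(1) by (simp add: is_partition_finite)
  show "finite_join {u \<in> U. u \<le> x} \<le> x"
    using fin by (simp add: finite_join_le_iff)
  have "sup (- x) (finite_join {u \<in> U. u \<le> x}) = top"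
    by (rule is_partition_top_le[OF assms(1)])
      (use assms(2) fin in \<open>auto simp: decided_def intro: le_supI1 le_supI2 le_finite_join\<close>)
  then show "x \<le> finite_join {u \<in> U. u \<le> x}"
    by (simp add: sup_shunt)
qed

text \<open>Induction on \<open>F\<close>: a new \<open>x\<close> cuts each member \<open>u\<close>
  into \<open>inf u x\<close> and \<open>inf u (- x)\<close>. The nonzero pieces form a finer
  partition, which decides \<open>x\<close> and still decides the earlier elements.\<close>

lemma finite_set_decided_by_partition:
  fixes F :: "'a::boolean_algebra set"
  assumes "finite F"
  shows "\<exists>U. is_partition U \<and> (\<forall>x\<in>F. decided U x)"
  using assms
proof (induction F rule: finite_induct)
  case empty
  \<comment> \<open>In the one-element algebra \<open>top\<close> is \<open>bot\<close>, and the
    partition is empty.\<close>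
  have "is_partition ({top} - {bot :: 'a})"
    by (cases "(bot :: 'a) = top") (auto simp: is_partition_def finite_join_def)
  then show ?case by blast
next
  case (insert x F)
  then obtain U where U: "is_partition U" "\<forall>y\<in>F. decided U y" by blast
  define V where "V = ((\<lambda>u. inf u x) ` U \<union> (\<lambda>u. inf u (- x)) ` U) - {bot}"
  have below: "\<exists>u\<in>U. (v = inf u x \<or> v = inf u (- x))" if "v \<in> V" for v
    using that by (auto simp: V_def)
  have fin: "finite V" using U(1) by (simp add: V_def is_partition_finite)
  have "inf v w = bot" if vw: "v \<in> V" "w \<in> V" "v \<noteq> w" for v w
  proof -
    obtain u u' where u: "u \<in> U" "v = inf u x \<or> v = inf u (- x)"
      and u': "u' \<in> U" "w = inf u' x \<or> w = inf u' (- x)"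
      using below vw by metis
    show ?thesis
    proof (cases "u = u'")
      case True
      then have "inf v w \<le> inf x (- x)"
        using u u' vw(3) by (auto intro: le_infI1 le_infI2)
      then show ?thesis by (simp add: bot_unique)
    next
      case False
      have "inf v w \<le> inf u u'"
        using u u' by (auto intro: le_infI1 le_infI2)
      then show ?thesis using is_partition_disjoint[OF U(1) u(1) u'(1) False] by (simp add: bot_unique)
    qed
  qed
  moreover have "finite_join V = top"
  proof (rule is_partition_top_le[OF U(1)])
    fix u assume u: "u \<in> U"
    have "inf u x \<le> finite_join V" "inf u (- x) \<le> finite_join V"
      using u fin by (cases "inf u x = bot"; cases "inf u (- x) = bot";
          auto simp: V_def intro: le_finite_join)+
    then have "sup (inf u x) (inf u (- x)) \<le> finite_join V" by simp
    moreover have "sup (inf u x) (inf u (- x)) = u"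
      by (simp flip: inf_sup_distrib1)
    ultimately show "u \<le> finite_join V" by simp
  qed
  moreover have "bot \<notin> V" by (simp add: V_def)
  ultimately have "is_partition V"
    using fin by (simp add: is_partition_def pairwise_def)
  moreover have "decided V y" if "y \<in> insert x F" for y
    unfolding decided_def
  proof
    fix v assume "v \<in> V"
    then obtain u where u: "u \<in> U" "v = inf u x \<or> v = inf u (- x)" using below by blast
    then have "u \<le> y \<or> u \<le> - y" if "y \<in> F"
      using U(2) that by (auto simp: decided_def)
    then show "v \<le> y \<or> v \<le> - y"
      using u that by (auto intro: le_infI1)
  qed
  ultimately show ?case by blast
qed

section \<open>Boolean homomorphisms and embeddings\<close>

lemma boolean_hom_sup: "boolean_hom h \<Longrightarrow> h (sup x y) = sup (h x) (h y)"
  and boolean_hom_inf: "boolean_hom h \<Longrightarrow> h (inf x y) = inf (h x) (h y)"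
  and boolean_hom_uminus: "boolean_hom h \<Longrightarrow> h (- x) = - h x"
  and boolean_hom_bot: "boolean_hom h \<Longrightarrow> h bot = bot"
  and boolean_hom_top: "boolean_hom h \<Longrightarrow> h top = top"
  by (simp_all add: boolean_hom_def)

lemma boolean_hom_mono: "boolean_hom h \<Longrightarrow> x \<le> y \<Longrightarrow> h x \<le> h y"
  by (metis boolean_hom_inf inf.orderE inf.orderI)

lemma boolean_hom_finite_join:
  assumes h: "boolean_hom h" and "finite U"
  shows "h (finite_join U) = finite_join (h ` U)"
  using assms(2)
  by induction
    (simp_all add: finite_join_empty finite_join_insert boolean_hom_bot[OF h] boolean_hom_sup[OF h])

text \<open>Infima follow by De Morgan, and \<open>top\<close> is \<open>sup top (- top)\<close>.
  Hence approximations will be controlled through suprema and complements.\<close>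

lemma boolean_homI:
  fixes h :: "'a::boolean_algebra \<Rightarrow> 'b::boolean_algebra"
  assumes sup: "\<And>x y. h (sup x y) = sup (h x) (h y)" and uminus: "\<And>x. h (- x) = - h x"
  shows "boolean_hom h"
proof -
  have top: "h top = top"
    using sup[of top "- top"] uminus[of top] by simp
  have "h bot = bot" using uminus[of top] top by simp
  moreover have "h (inf x y) = inf (h x) (h y)" for x y
    using uminus[of "sup (- x) (- y)"] by (simp add: sup uminus)
  ultimately show ?thesis using sup uminus top by (simp add: boolean_hom_def)
qed

text \<open>If \<open>h x = h y\<close>, then \<open>h\<close> sends the difference
  \<open>inf x (- y)\<close> to \<open>bot\<close>, so a trivial kernel gives
  \<open>x \<le> y\<close>, and by symmetry equality.\<close>

lemma boolean_hom_inj: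
  assumes h: "boolean_hom h" and "\<And>x. x \<noteq> bot \<Longrightarrow> h x \<noteq> bot"
  shows "inj h"
proof (rule injI)
  have le: "x \<le> y" if "h x = h y" for x y
  proof -
    have "h (inf x (- y)) = bot" using that h by (simp add: boolean_hom_inf boolean_hom_uminus)
    then show ?thesis using assms(2) by (metis inf_shunt double_compl)
  qed
  fix x y assume "h x = h y"
  then show "x = y" using le[of x y] le[of y x] by simp
qed

lemma embedding_eq_bot_iff:
  "embedding \<alpha> \<beta> h \<Longrightarrow> h x = bot \<longleftrightarrow> x = bot"
  by (metis embedding_def boolean_hom_bot injD)

lemma embedding_commute: "embedding \<alpha> \<beta> h \<Longrightarrow> h (\<alpha> x) = \<beta> (h x)"
  by (metis embedding_def comp_apply)

lemma is_partition_image: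
  assumes h: "embedding \<alpha> \<beta> h" and U: "is_partition U"
  shows "is_partition (h ` U)"
proof -
  have hom: "boolean_hom h" using h by (simp add: embedding_def)
  have "finite_join (h ` U) = h (finite_join U)"
    using boolean_hom_finite_join[OF hom is_partition_finite[OF U]] by simp
  moreover have "inf (h u) (h v) = bot" if "u \<in> U" "v \<in> U" "h u \<noteq> h v" for u v
  proof -
    have "inf u v = bot" using is_partition_disjoint[OF U] that by blast
    then show ?thesis by (metis hom boolean_hom_inf boolean_hom_bot)
  qed
  ultimately show ?thesis
    using U embedding_eq_bot_iff[OF h]
    by (auto simp: is_partition_def pairwise_def boolean_hom_top[OF hom] dest: sym[of bot])
qed

section \<open>Refinement in terms of decided elements\<close>

lemma refining_partition_decides:
  assumes "is_partition U" "refines V U" "u \<in> U"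
  shows "decided V u"
  unfolding decided_def
proof
  fix v assume "v \<in> V"
  then obtain u' where u': "u' \<in> U" "v \<le> u'" using assms(2) by (auto simp: refines_def)
  show "v \<le> u \<or> v \<le> - u"
  proof (cases "u' = u")
    case False
    then have "u' \<le> - u"
      using is_partition_disjoint[OF assms(1) u'(1) assms(3)] inf_eq_bot_iff_le_compl by blast
    then show ?thesis using u' by auto
  qed (use u' in simp)
qed

text \<open>A member \<open>v\<close> of \<open>V\<close> below no \<open>u\<close> would lie below
  every \<open>- u\<close>; then \<open>- v\<close> is above all of \<open>U\<close>, hence
  \<open>top\<close>, and \<open>v\<close> is zero.\<close>

lemma deciding_partition_refines:
  assumes "is_partition U" "is_partition V" "\<forall>u\<in>U. decided V u"
  shows "refines V U"
  unfolding refines_def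
proof (rule ballI, rule ccontr)
  fix v assume v: "v \<in> V" "\<not> (\<exists>u\<in>U. v \<le> u)"
  have "- v = top"
  proof (rule is_partition_top_le[OF assms(1)])
    fix u assume "u \<in> U"
    then have "v \<le> - u" using v assms(3) by (auto simp: decided_def)
    then show "u \<le> - v" by (metis compl_le_swap1)
  qed
  then have "v = bot" by (metis compl_top_eq double_compl)
  then show False using is_partition_nonbot[OF assms(2) v(1)] by simp
qed

section \<open>Extending a map of partitions\<close>

text \<open>The expression that (\<dagger>) writes as the value of the digraph isomorphism at
  \<iota>(a). For a bijection \<tau> between partitions it acts on decided elements as the
  homomorphism induced by \<tau>.\<close>

definition join_extension :: "('b::boolean_algebra \<Rightarrow> 'c::boolean_algebra) \<Rightarrow> 'b set \<Rightarrow> 'b \<Rightarrow> 'c" where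
  "join_extension \<tau> B x = finite_join (\<tau> ` {b \<in> B. b \<le> x})"

context
  fixes B :: "'b::boolean_algebra set" and C :: "'c::boolean_algebra set" and \<tau>
  assumes B: "is_partition B" and C: "is_partition C" and bij: "bij_betw \<tau> B C"
begin

lemma join_extension_le_iff:
  "join_extension \<tau> B x \<le> z \<longleftrightarrow> (\<forall>b\<in>B. b \<le> x \<longrightarrow> \<tau> b \<le> z)"
  unfolding join_extension_def
  using is_partition_finite[OF B] by (subst finite_join_le_iff) auto

lemma le_join_extension: "b \<in> B \<Longrightarrow> b \<le> x \<Longrightarrow> \<tau> b \<le> join_extension \<tau> B x"
  using join_extension_le_iff by blast

lemma join_extension_mono: "x \<le> y \<Longrightarrow> join_extension \<tau> B x \<le> join_extension \<tau> B y"
  unfolding join_extension_le_iff using le_join_extension order_trans by blast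

text \<open>A member of \<open>B\<close> below \<open>sup x y\<close> is below \<open>x\<close>, or
  else below \<open>- x\<close> and then below \<open>y\<close>.\<close>

lemma join_extension_sup:
  assumes x: "decided B x"
  shows "join_extension \<tau> B (sup x y) = sup (join_extension \<tau> B x) (join_extension \<tau> B y)"
proof (rule antisym)
  show "join_extension \<tau> B (sup x y) \<le> sup (join_extension \<tau> B x) (join_extension \<tau> B y)"
    unfolding join_extension_le_iff
  proof (intro ballI impI)
    fix b assume b: "b \<in> B" "b \<le> sup x y"
    consider "b \<le> x" | "b \<le> - x" using x b(1) by (auto simp: decided_def)
    then show "\<tau> b \<le> sup (join_extension \<tau> B x) (join_extension \<tau> B y)"
    proof cases
      case 1
      then show ?thesis using b le_join_extension by (blast intro: le_supI1)
    next
      case 2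
      then have "b \<le> inf (sup x y) (- x)" using b by simp
      also have "\<dots> \<le> y" by (simp add: inf_sup_distrib2)
      finally show ?thesis using b le_join_extension by (blast intro: le_supI2)
    qed
  qed
qed (simp add: join_extension_mono)

text \<open>The two values are disjoint because \<tau> is injective into pairwise disjoint elements,
  and they cover \<open>top\<close> because \<tau> is onto \<open>C\<close> and each member of
  \<open>B\<close> is under \<open>x\<close> or \<open>- x\<close>.\<close>

lemma join_extension_uminus:
  assumes x: "decided B x"
  shows "join_extension \<tau> B (- x) = - join_extension \<tau> B x"
proof (rule sym, rule compl_unique)
  have "join_extension \<tau> B x \<le> - \<tau> b" if b: "b \<in> B" "b \<le> - x" for b
    unfolding join_extension_le_iff
  proof (intro ballI impI)
    fix b' assume b': "b' \<in> B" "b' \<le> x"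
    have "b \<noteq> b'"
    proof
      assume "b = b'"
      then have "b \<le> inf x (- x)" using b b' by (intro le_infI) auto
      then show False using is_partition_nonbot[OF B b(1)] by (simp add: bot_unique)
    qed
    then have "\<tau> b' \<noteq> \<tau> b" using bij b(1) b'(1) by (auto simp: bij_betw_def dest: inj_onD)
    then have "inf (\<tau> b') (\<tau> b) = bot"
      using is_partition_disjoint[OF C] bij b(1) b'(1) by (metis bij_betwE)
    then show "\<tau> b' \<le> - \<tau> b" by (simp add: inf_eq_bot_iff_le_compl)
  qed
  then have "join_extension \<tau> B (- x) \<le> - join_extension \<tau> B x"
    unfolding join_extension_le_iff[of "- x"] by (metis compl_le_swap1)
  then show "inf (join_extension \<tau> B x) (join_extension \<tau> B (- x)) = bot"
    by (metis inf_eq_bot_iff_le_compl inf_commute)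
  show "sup (join_extension \<tau> B x) (join_extension \<tau> B (- x)) = top"
  proof (rule is_partition_top_le[OF C])
    fix c assume "c \<in> C"
    then obtain b where b: "b \<in> B" "c = \<tau> b" using bij by (auto simp: bij_betw_def)
    then show "c \<le> sup (join_extension \<tau> B x) (join_extension \<tau> B (- x))"
      using x le_join_extension unfolding decided_def by (metis le_supI1 le_supI2)
  qed
qed

lemma join_extension_nonbot:
  assumes "decided B x" "x \<noteq> bot"
  shows "join_extension \<tau> B x \<noteq> bot"
proof
  assume bot: "join_extension \<tau> B x = bot"
  have "\<not> b \<le> x" if "b \<in> B" for b
    using that bot bij is_partition_nonbot[OF C] le_join_extension
    by (metis bij_betwE bot_unique)
  then have "{b \<in> B. b \<le> x} = {}" by blast
  then have "x = bot"
    using join_below_decided[OF B assms(1)] by (simp only: finite_join_def) simp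
  with assms(2) show False by simp
qed

text \<open>If \<open>b \<le> x\<close> and \<open>b' \<le> - \<beta> x\<close>, there is no arrow
  from \<open>b\<close> to \<open>b'\<close>, so none between their images, and
  \<open>\<gamma> (\<tau> b)\<close> misses the extension at \<open>- \<beta> x\<close>. This gives
  one inequality; the same at \<open>- x\<close>, complemented, gives the other.\<close>

lemma join_extension_commute:
  assumes \<beta>: "boolean_hom \<beta>" and \<gamma>: "boolean_hom \<gamma>"
    and arrows: "\<And>b b'. b \<in> B \<Longrightarrow> b' \<in> B \<Longrightarrow> arrow \<gamma> (\<tau> b) (\<tau> b') \<Longrightarrow> arrow \<beta> b b'"
    and x: "decided B x" and \<beta>x: "decided B (\<beta> x)"
  shows "join_extension \<tau> B (\<beta> x) = \<gamma> (join_extension \<tau> B x)"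
proof -
  have le: "\<gamma> (join_extension \<tau> B x) \<le> join_extension \<tau> B (\<beta> x)" if \<beta>x: "decided B (\<beta> x)" for x
  proof -
    have "join_extension \<tau> B (- \<beta> x) \<le> - \<gamma> (\<tau> b)" if b: "b \<in> B" "b \<le> x" for b
      unfolding join_extension_le_iff
    proof (intro ballI impI)
      fix b' assume b': "b' \<in> B" "b' \<le> - \<beta> x"
      have "inf (\<beta> b) b' \<le> inf (\<beta> x) (- \<beta> x)"
        using b b' boolean_hom_mono[OF \<beta>] by (blast intro: inf_mono)
      then have "\<not> arrow \<beta> b b'" by (simp add: arrow_def bot_unique)
      then have "\<not> arrow \<gamma> (\<tau> b) (\<tau> b')" using arrows b b' by blast
      then have "inf (\<tau> b') (\<gamma> (\<tau> b)) = bot"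
        by (simp add: arrow_def inf_commute)
      then show "\<tau> b' \<le> - \<gamma> (\<tau> b)"
        by (simp add: inf_eq_bot_iff_le_compl)
    qed
    then have *: "\<gamma> (\<tau> b) \<le> join_extension \<tau> B (\<beta> x)" if "b \<in> B" "b \<le> x" for b
      using that join_extension_uminus[OF \<beta>x] by (metis compl_le_compl_iff)
    have "\<gamma> (join_extension \<tau> B x) = finite_join (\<gamma> ` \<tau> ` {b \<in> B. b \<le> x})"
      unfolding join_extension_def
      using is_partition_finite[OF B] by (intro boolean_hom_finite_join[OF \<gamma>]) simp
    also have "\<dots> \<le> join_extension \<tau> B (\<beta> x)"
      using * is_partition_finite[OF B] by (subst finite_join_le_iff) auto
    finally show ?thesis .
  qed
  have "- \<gamma> (join_extension \<tau> B x) \<le> - join_extension \<tau> B (\<beta> x)"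
    using le[of "- x"] x \<beta>x \<beta> \<gamma>
    by (simp add: boolean_hom_uminus join_extension_uminus decided_uminus)
  with le[OF \<beta>x] show ?thesis by (simp add: antisym)
qed

end

section \<open>Splicing approximations along time\<close>

text \<open>Sequential compactness of Cantor space: \<open>P i n\<close> is coordinate
  \<open>i\<close> of the \<open>n\<close>-th point, and \<open>r\<close> selects a subsequence
  converging to \<open>v\<close>.\<close>

lemma diagonal_eventually_const:
  fixes P :: "nat \<Rightarrow> nat \<Rightarrow> bool"
  shows "\<exists>r v. strict_mono (r :: nat \<Rightarrow> nat) \<and> (\<forall>i. \<forall>\<^sub>F n in sequentially. P i (r n) = v i)"
proof -
  \<comment> \<open>Stage \<open>i\<close> makes coordinate \<open>i\<close> constant, by the
    pigeonhole principle on two truth values.\<close>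
  interpret subseqs "\<lambda>i s. \<exists>v. \<forall>n. P i (s n) = v"
  proof
    fix i :: nat and s :: "nat \<Rightarrow> nat"
    have "infinite ({n. P i (s n) = True} \<union> {n. P i (s n) = False})"
      by (simp add: Collect_neg_eq Compl_partition)
    then obtain v where v: "infinite {n. P i (s n) = v}"
      unfolding finite_Un by blast
    obtain r where "strict_mono (r :: nat \<Rightarrow> nat)" "\<forall>n. P i ((s \<circ> r) n) = v"
      using infinite_enumerate[OF v] unfolding comp_apply mem_Collect_eq by blast
    then show "\<exists>r :: nat \<Rightarrow> nat. strict_mono r \<and> (\<exists>v. \<forall>n. P i ((s \<circ> r) n) = v)"
      by (intro exI conjI)
  qed
  \<comment> \<open>From index \<open>Suc i\<close> on, the diagonal runs inside the subsequence
    that fixed coordinate \<open>i\<close>; the limit is read off there.\<close>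
  define v where "v i = P i (diagseq (Suc i))" for i
  have const: "\<exists>v. \<forall>n. P i ((diagseq \<circ> (+) (Suc i)) n) = v" for i
  proof (rule diagseq_holds)
    fix r s :: "nat \<Rightarrow> nat" and n :: nat
    assume "\<exists>v. \<forall>n'. P n (s n') = v"
    then obtain v where "\<forall>n'. P n (s n') = v" by (rule exE)
    then have "\<forall>n'. P n ((s \<circ> r) n') = v" by simp
    then show "\<exists>v. \<forall>n'. P n ((s \<circ> r) n') = v" by (rule exI)
  qed
  have v: "P i (diagseq n) = v i" if "Suc i \<le> n" for i n
  proof -
    obtain w where "\<forall>n. P i ((diagseq \<circ> (+) (Suc i)) n) = w"
      using const[of i] by (rule exE)
    then have w: "P i (diagseq (Suc i + k)) = w" for k by simp
    show ?thesis using w[of 0] w[of "n - Suc i"] that by (simp add: v_def)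
  qed
  have "\<forall>\<^sub>F n in sequentially. P i (diagseq n) = v i" for i
    using eventually_ge_at_top[of "Suc i"] by eventually_elim (rule v)
  then show ?thesis using subseq_diagseq by (intro exI[of _ diagseq] exI[of _ v]) simp
qed

text \<open>Here \<open>h m x k\<close> is the truth value of \<open>x\<close> at time
  \<open>k\<close> under approximation \<open>m\<close>, \<open>K m\<close> is the time from which
  \<open>m\<close> may be used, and \<open>s k\<close> is the approximation followed at time
  \<open>k\<close>. Each one is kept until the monitored elements that recur under it have occurred,
  and is left at a time when it agrees with its successor. The last conclusion will keep nonzero
  elements nonzero.\<close>

lemma splice:
  fixes h :: "nat \<Rightarrow> 'i \<Rightarrow> nat \<Rightarrow> bool" and K :: "nat \<Rightarrow> nat"
  assumes "countable (UNIV :: 'i set)"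
  shows "\<exists>s :: nat \<Rightarrow> nat. (\<forall>N. \<forall>\<^sub>F k in sequentially. N \<le> s k) \<and>
    (\<forall>\<^sub>F k in sequentially. K (s k) \<le> k) \<and>
    (\<forall>x. \<forall>\<^sub>F k in sequentially. h (s k) x (Suc k) = h (s (Suc k)) x (Suc k)) \<and>
    (\<forall>x. (\<forall>\<^sub>F m in sequentially. \<exists>\<^sub>F k in sequentially. h m x k) \<longrightarrow>
      (\<exists>\<^sub>F k in sequentially. h (s k) x k))"
proof -
  define e :: "nat \<Rightarrow> 'i" where "e = from_nat_into UNIV"
  have e: "\<exists>j. x = e j" for x
    using from_nat_into_surj[OF assms, of x] by (auto simp: e_def)
  \<comment> \<open>One sequence of times \<open>r n\<close> serves all approximations: coding the
    pairs (m, j) by numbers makes a single diagonal argument suffice. The limit of approximation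
    \<open>m\<close> is \<open>v m\<close>.\<close>
  obtain r v where r: "strict_mono (r :: nat \<Rightarrow> nat)"
    and rv: "\<And>m j. \<forall>\<^sub>F n in sequentially. h m (e j) (r n) = v m j"
  proof -
    obtain r v where "strict_mono (r :: nat \<Rightarrow> nat)"
      and *: "\<And>i. \<forall>\<^sub>F n in sequentially. h (fst (prod_decode i)) (e (snd (prod_decode i))) (r n) = v i"
      using diagonal_eventually_const[of "\<lambda>i. h (fst (prod_decode i)) (e (snd (prod_decode i)))"]
      by (elim exE conjE) (rule that, auto)
    then show ?thesis
      using that[of r "\<lambda>m j. v (prod_encode (m, j))"] *[of "prod_encode (_, _)"] by simp
  qed
  \<comment> \<open>Compactness is used a second time, now for the limits \<open>v m\<close>
    themselves.\<close>
  obtain q l where q: "strict_mono (q :: nat \<Rightarrow> nat)"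
    and ql: "\<And>j. \<forall>\<^sub>F n in sequentially. v (q n) j = l j"
    using diagonal_eventually_const[of "\<lambda>j m. v m j"] by (elim exE conjE) (rule that, auto)
  have "\<exists>m\<ge>i. \<forall>j\<le>i. v m j = l j" for i
  proof -
    have "\<forall>\<^sub>F n in sequentially. \<forall>j\<in>{..i}. v (q n) j = l j"
      using ql by (intro eventually_ball_finite) auto
    then obtain N where "\<forall>n\<ge>N. \<forall>j\<in>{..i}. v (q n) j = l j"
      by (auto simp: eventually_sequentially)
    then show ?thesis
      using seq_suble[OF q, of "max N i"] by (intro exI[of _ "q (max N i)"]) auto
  qed
  then obtain m where m_ge: "\<And>i. i \<le> m i" and vm: "\<And>i j. j \<le> i \<Longrightarrow> v (m i) j = l j"
    by metis
  text \<open>At \<open>t (i + 1)\<close> the approximations \<open>m i\<close> and \<open>m (i + 1)\<close> agree on the first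
    \<open>i + 1\<close> indices, because both have reached their common limit \<open>l\<close>.\<close>
  define step where "step i a b \<longleftrightarrow> a < b \<and>
      (\<forall>j\<le>i. h (m i) (e j) b = h (m (Suc i)) (e j) b) \<and>
      (\<forall>j\<le>i. (\<exists>\<^sub>F k in sequentially. h (m i) (e j) k) \<longrightarrow> (\<exists>k. a \<le> k \<and> k < b \<and> h (m i) (e j) k))"
    for i a b
  \<comment> \<open>Any sufficiently late \<open>r n\<close> can be the next switching time, since
    finitely many eventual conditions are imposed. The bound uses \<open>K (m (Suc i))\<close>
    because that approximation takes over at \<open>b\<close>.\<close>
  have ex_step: "\<exists>b. K (m (Suc i)) \<le> b \<and> step i a b" for i a
  proof -
    have "\<forall>\<^sub>F n in sequentially. \<forall>j\<in>{..i}. h (m i) (e j) (r n) = v (m i) j"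
         "\<forall>\<^sub>F n in sequentially. \<forall>j\<in>{..i}. h (m (Suc i)) (e j) (r n) = v (m (Suc i)) j"
      using rv by (intro eventually_ball_finite; auto)+
    moreover have "\<forall>\<^sub>F n in sequentially. \<forall>j\<in>{..i}.
        (\<exists>\<^sub>F k in sequentially. h (m i) (e j) k) \<longrightarrow> (\<exists>k. a \<le> k \<and> k < r n \<and> h (m i) (e j) k)"
    proof (intro eventually_ball_finite ballI)
      fix j
      show "\<forall>\<^sub>F n in sequentially.
        (\<exists>\<^sub>F k in sequentially. h (m i) (e j) k) \<longrightarrow> (\<exists>k. a \<le> k \<and> k < r n \<and> h (m i) (e j) k)"
      proof (cases "\<exists>\<^sub>F k in sequentially. h (m i) (e j) k")
        case True
        then obtain k where "a \<le> k" "h (m i) (e j) k"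
          by (auto simp: frequently_sequentially)
        moreover have "\<forall>\<^sub>F n in sequentially. k < r n"
          using seq_suble[OF r] unfolding eventually_sequentially
          by (metis Suc_le_eq order_trans)
        ultimately show ?thesis by (auto elim: eventually_mono)
      qed simp
    qed simp
    moreover have "\<forall>\<^sub>F n in sequentially. Suc a + K (m (Suc i)) \<le> r n"
      using seq_suble[OF r] unfolding eventually_sequentially by (metis order_trans)
    ultimately have "\<forall>\<^sub>F n in sequentially. K (m (Suc i)) \<le> r n \<and> step i a (r n)"
      by eventually_elim (auto simp: step_def vm)
    then show ?thesis by (auto simp: eventually_sequentially)
  qed
  have "\<exists>t. \<forall>i. K (m i) \<le> t i \<and> step i (t i) (t (Suc i))"
    by (rule dependent_nat_choice) (use ex_step in auto)
  then obtain t where tK: "\<And>i. K (m i) \<le> t i" and step: "\<And>i. step i (t i) (t (Suc i))"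
    by blast
  have t_mono: "strict_mono t"
    using step by (auto simp: strict_mono_Suc_iff step_def)
  \<comment> \<open>For \<open>k\<close> from \<open>t 0\<close> on, this is the index of the
    interval from \<open>t i\<close> to \<open>t (Suc i)\<close> containing \<open>k\<close>; before
    \<open>t 0\<close> it is 0.\<close>
  define stage where "stage k = (LEAST i. k < t (Suc i))" for k
  have stage_less: "k < t (Suc (stage k))" for k
    unfolding stage_def
    by (rule LeastI_ex) (metis seq_suble[OF t_mono] Suc_le_eq)
  have stage_ge: "i \<le> stage k" if "t i \<le> k" for i k
    using stage_less[of k] that strict_mono_less[OF t_mono, of i "Suc (stage k)"] by auto
  have stage_eq: "stage k = i" if "t i \<le> k" "k < t (Suc i)" for i k
    using stage_ge[OF that(1)] that(2) by (auto simp: stage_def intro: antisym Least_le)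
  have t_stage: "t (stage k) \<le> k" if "t 0 \<le> k" for k
  proof (cases "stage k")
    case (Suc i)
    then show ?thesis
      using not_less_Least[of i "\<lambda>i. k < t (Suc i)"] by (simp add: stage_def)
  qed (use that in simp)
  define s where "s k = m (stage k)" for k
  have ge: "\<forall>\<^sub>F k in sequentially. N \<le> stage k" for N
    using stage_ge by (auto simp: eventually_sequentially)
  have "\<forall>\<^sub>F k in sequentially. N \<le> s k" for N
    using ge[of N] by eventually_elim (use m_ge order_trans s_def in metis)
  moreover have "\<forall>\<^sub>F k in sequentially. K (s k) \<le> k"
    using eventually_ge_at_top[of "t 0"]
    by eventually_elim (use tK t_stage order_trans s_def in metis)
  moreover have "\<forall>\<^sub>F k in sequentially. h (s k) x (Suc k) = h (s (Suc k)) x (Suc k)" for x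
  proof -
    obtain j where j: "x = e j" using e by blast
    from ge[of j] eventually_ge_at_top[of "t 0"] show ?thesis
    proof eventually_elim
      case (elim k)
      \<comment> \<open>Only in the second case does the approximation change, and there
        \<open>step\<close> supplies agreement at \<open>x = e j\<close>, as
        \<open>j \<le> stage k\<close>.\<close>
      consider "Suc k < t (Suc (stage k))" | "Suc k = t (Suc (stage k))"
        using stage_less[of k] by linarith
      then show ?case
      proof cases
        case 1
        then have "stage (Suc k) = stage k" using t_stage[of k] elim by (intro stage_eq) auto
        then show ?thesis by (simp add: s_def)
      next
        case 2
        then have "stage (Suc k) = Suc (stage k)"
          using step[of "Suc (stage k)"] by (intro stage_eq) (auto simp: step_def)
        then show ?thesis using step[of "stage k"] 2 elim by (simp add: s_def step_def j)
      qed
    qed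
  qed
  moreover have "\<exists>\<^sub>F k in sequentially. h (s k) x k"
    if fr: "\<forall>\<^sub>F m in sequentially. \<exists>\<^sub>F k in sequentially. h m x k" for x
    unfolding frequently_sequentially
  proof
    fix N
    obtain j where j: "x = e j" using e by blast
    obtain N' where N': "\<And>m. N' \<le> m \<Longrightarrow> \<exists>\<^sub>F k in sequentially. h m x k"
      using fr by (auto simp: eventually_sequentially)
    \<comment> \<open>The three bounds ensure in turn that the stage starts after \<open>N\<close>,
      that \<open>x\<close> recurs under \<open>m i\<close>, and that \<open>x\<close> is monitored
      at stage \<open>i\<close>.\<close>
    define i where "i = max N (max N' j)"
    have "\<exists>\<^sub>F k in sequentially. h (m i) (e j) k"
      using N'[of "m i"] m_ge[of i] j by (auto simp: i_def)
    moreover have "j \<le> i" by (simp add: i_def)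
    ultimately obtain k where k: "t i \<le> k" "k < t (Suc i)" "h (m i) (e j) k"
      using step[of i] by (auto simp: step_def)
    have "N \<le> k" using seq_suble[OF t_mono, of i] k(1) by (simp add: i_def)
    moreover have "h (s k) x k" using stage_eq[OF k(1,2)] k(3) by (simp add: s_def j)
    ultimately show "\<exists>n\<ge>N. h (s n) x n" by blast
  qed
  ultimately show ?thesis by blast
qed

section \<open>Representatives modulo finite sets\<close>

text \<open>The symmetric difference is the set of times of disagreement. Equations in the quotient
  thus become statements about almost all times.\<close>

lemma eq_mod_fin_iff_eventually:
  "eq_mod_fin X Y \<longleftrightarrow> (\<forall>\<^sub>F k in sequentially. k \<in> X \<longleftrightarrow> k \<in> Y)"
proof -
  have "X - Y \<union> (Y - X) = {k. \<not> (k \<in> X \<longleftrightarrow> k \<in> Y)}" by auto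
  then show ?thesis by (simp add: eq_mod_fin_def eventually_cofinite flip: cofinite_eq_sequentially)
qed

lemma eq_pomega_fin_iff:
  "x = y \<longleftrightarrow> (\<forall>\<^sub>F k in sequentially. k \<in> rep_pomega_fin x \<longleftrightarrow> k \<in> rep_pomega_fin y)"
  using Quotient3_rel_rep[OF Quotient3_pomega_fin, of x y] by (simp add: eq_mod_fin_iff_eventually)

lemma rep_abs_pomega_fin:
  "\<forall>\<^sub>F k in sequentially. k \<in> rep_pomega_fin (abs_pomega_fin X) \<longleftrightarrow> k \<in> X"
  using rep_abs_rsp_left[OF Quotient3_pomega_fin, of X X] equivp_reflp[OF equivp_eq_mod_fin, of X]
  by (simp add: eq_mod_fin_iff_eventually)

lemma abs_rep_pomega_fin: "abs_pomega_fin (rep_pomega_fin x) = x"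
  by (rule Quotient3_abs_rep[OF Quotient3_pomega_fin])

lemma rep_sup_pomega_fin:
  "\<forall>\<^sub>F k in sequentially. k \<in> rep_pomega_fin (sup x y) \<longleftrightarrow>
    k \<in> rep_pomega_fin x \<or> k \<in> rep_pomega_fin y"
  using rep_abs_pomega_fin[of "rep_pomega_fin x \<union> rep_pomega_fin y"]
  by (simp add: abs_rep_pomega_fin flip: sup_pomega_fin.abs_eq)

lemma rep_uminus_pomega_fin:
  "\<forall>\<^sub>F k in sequentially. k \<in> rep_pomega_fin (- x) \<longleftrightarrow> k \<notin> rep_pomega_fin x"
  using rep_abs_pomega_fin[of "- rep_pomega_fin x"]
  by (simp add: abs_rep_pomega_fin flip: uminus_pomega_fin.abs_eq)

text \<open>Membership is compared at \<open>Suc k\<close>, which avoids predecessors and the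
  exceptional point 0.\<close>

lemma rep_shift:
  "\<forall>\<^sub>F k in sequentially. Suc k \<in> rep_pomega_fin (shift x) \<longleftrightarrow> k \<in> rep_pomega_fin x"
proof -
  have "\<forall>\<^sub>F k in sequentially. k \<in> rep_pomega_fin (shift x) \<longleftrightarrow> k \<in> Suc ` rep_pomega_fin x"
    using rep_abs_pomega_fin[of "Suc ` rep_pomega_fin x"]
    by (simp add: abs_rep_pomega_fin flip: shift.abs_eq)
  then show ?thesis
    by (subst (asm) eventually_sequentially_Suc[symmetric]) (simp add: image_iff)
qed

lemma frequently_rep_pomega_fin:
  "(\<exists>\<^sub>F k in sequentially. k \<in> rep_pomega_fin x) \<longleftrightarrow> x \<noteq> bot"
proof -
  have "\<forall>\<^sub>F k in sequentially. k \<notin> rep_pomega_fin (bot :: pomega_fin)"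
    using rep_abs_pomega_fin[of "{}"] by (simp add: bot_pomega_fin.abs_eq)
  then have "x = bot \<longleftrightarrow> (\<forall>\<^sub>F k in sequentially. k \<notin> rep_pomega_fin x)"
    unfolding eq_pomega_fin_iff by (auto elim: eventually_elim2)
  then show ?thesis by (simp add: frequently_def)
qed

section \<open>From finite approximations to an embedding\<close>

text \<open>The arguments range over \<open>E\<close>, but \<open>sup x y\<close>,
  \<open>- x\<close> and \<open>\<beta> x\<close> may lie outside it; \<open>g\<close> is total, so
  the identities still make sense.\<close>

definition approximates ::
    "('b::boolean_algebra \<Rightarrow> 'b) \<Rightarrow> ('a \<Rightarrow> 'b) \<Rightarrow> ('a \<Rightarrow> pomega_fin) \<Rightarrow> 'b set \<Rightarrow>
      ('b \<Rightarrow> pomega_fin) \<Rightarrow> bool"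
  where "approximates \<beta> \<iota> \<eta> E g \<longleftrightarrow>
    (\<forall>x\<in>E. \<forall>y\<in>E. g (sup x y) = sup (g x) (g y)) \<and>
    (\<forall>x\<in>E. g (- x) = - g x \<and> g (\<beta> x) = shift (g x) \<and> (x \<noteq> bot \<longrightarrow> g x \<noteq> bot)) \<and>
    (\<forall>a. \<iota> a \<in> E \<longrightarrow> g (\<iota> a) = \<eta> a)"

text \<open>A partition \<open>A\<close> deciding the elements that \<iota> maps into
  \<open>E\<close> is chosen first, then \<open>B\<close>. Condition (\<dagger>) gives \<tau>, and
  \<open>join_extension \<tau> B\<close> is the approximation.\<close>

lemma finite_approximation:
  fixes \<alpha> :: "'a::boolean_algebra \<Rightarrow> 'a" and \<beta> :: "'b::boolean_algebra \<Rightarrow> 'b"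
  assumes \<beta>: "dynamical_system \<beta>"
    and \<iota>: "embedding \<alpha> \<beta> \<iota>" and \<eta>: "embedding \<alpha> shift \<eta>"
    and dagger: "\<And>A B. is_partition A \<Longrightarrow> is_partition B \<Longrightarrow> refines B (\<iota> ` A) \<Longrightarrow>
      \<exists>C \<tau>. is_partition C \<and> refines C (\<eta> ` A) \<and>
        digraph_iso_betw B (arrow \<beta>) C (arrow shift) \<tau> \<and>
        (\<forall>a\<in>A. finite_join (\<tau> ` {b \<in> B. b \<le> \<iota> a}) = \<eta> a)"
    and E: "finite E"
  shows "\<exists>g. approximates \<beta> \<iota> \<eta> E g"
proof -
  have \<iota>_hom: "boolean_hom \<iota>" and \<iota>_inj: "inj \<iota>" and \<eta>_hom: "boolean_hom \<eta>"
    using \<iota> \<eta> by (auto simp: embedding_def)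
  have "finite (\<iota> -` E)" using E \<iota>_inj by (rule finite_vimageI)
  then obtain A where A: "is_partition A" "\<forall>a\<in>\<iota> -` E. decided A a"
    using finite_set_decided_by_partition by blast
  \<comment> \<open>Deciding \<open>\<beta>\<close>
    E\<open>yields commutation with the shift; deciding\<close>\<iota> \<open>A\<close> makes
    \<open>B\<close> refine it.\<close>
  obtain B where B: "is_partition B" "\<forall>x\<in>E \<union> \<beta> ` E \<union> \<iota> ` A. decided B x"
    using finite_set_decided_by_partition[of "E \<union> \<beta> ` E \<union> \<iota> ` A"] E is_partition_finite[OF A(1)]
    by auto
  have "refines B (\<iota> ` A)"
    using deciding_partition_refines[OF is_partition_image[OF \<iota> A(1)] B(1)] B(2) by blast
  from dagger[OF A(1) B(1) this] obtain C \<tau> where C: "is_partition C"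
    and iso: "digraph_iso_betw B (arrow \<beta>) C (arrow shift) \<tau>"
    and \<tau>: "\<And>a. a \<in> A \<Longrightarrow> join_extension \<tau> B (\<iota> a) = \<eta> a"
    by (auto simp: join_extension_def)
  have bij: "bij_betw \<tau> B C" using iso by (simp add: digraph_iso_betw_def)
  note ext = B(1) C bij
  have "join_extension \<tau> B (\<beta> x) = shift (join_extension \<tau> B x)" if "x \<in> E" for x
    by (rule join_extension_commute[OF ext])
      (use that iso B(2) \<beta> dynamical_system_shift
        in \<open>auto simp: dynamical_system_def digraph_iso_betw_def\<close>)
  moreover have "join_extension \<tau> B (\<iota> a) = \<eta> a" if a: "\<iota> a \<in> E" for a
  proof -
    \<comment> \<open>Agreement is given on members of \<open>A\<close> and passes to their joins;
      the reverse inequality comes from applying this to \<open>- a\<close>.\<close>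
    have le: "\<eta> a \<le> join_extension \<tau> B (\<iota> a)" if "decided A a" for a
    proof -
      have "\<eta> a = \<eta> (finite_join {a' \<in> A. a' \<le> a})"
        using join_below_decided[OF A(1) that] by simp
      also have "\<dots> = finite_join (\<eta> ` {a' \<in> A. a' \<le> a})"
        using is_partition_finite[OF A(1)] by (intro boolean_hom_finite_join[OF \<eta>_hom]) simp
      also have "\<dots> \<le> join_extension \<tau> B (\<iota> a)"
        using is_partition_finite[OF A(1)] join_extension_mono[OF ext boolean_hom_mono[OF \<iota>_hom]]
        by (subst finite_join_le_iff) (auto simp flip: \<tau>)
      finally show ?thesis .
    qed
    have "decided A a" "decided B (\<iota> a)" using a A(2) B(2) by auto
    moreover from this have "- \<eta> a \<le> - join_extension \<tau> B (\<iota> a)"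
      using le[of "- a"] by (simp add: decided_uminus boolean_hom_uminus \<iota>_hom \<eta>_hom
          join_extension_uminus[OF ext])
    ultimately show ?thesis using le[of a] by (simp add: antisym)
  qed
  ultimately show ?thesis
    unfolding approximates_def
    using B(2) join_extension_sup[OF ext] join_extension_uminus[OF ext] join_extension_nonbot[OF ext]
    by (intro exI[of _ "join_extension \<tau> B"]) auto
qed

text \<open>The finite sets \<open>E m\<close> exhaust the countable algebra. Splicing their
  approximations gives, for each \<open>x\<close>, the set of times \<open>k\<close> with
  \<open>h (s k) x k\<close>, whose class is the value at \<open>x\<close>.\<close>

lemma embedding_extends_if_approximable:
  fixes \<beta> :: "'b::boolean_algebra \<Rightarrow> 'b" and \<iota> :: "'a \<Rightarrow> 'b" and \<eta> :: "'a \<Rightarrow> pomega_fin"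
  assumes "countable (UNIV :: 'b set)"
    and approx: "\<And>E. finite E \<Longrightarrow> \<exists>g. approximates \<beta> \<iota> \<eta> E g"
  shows "\<exists>\<eta>'. embedding \<beta> shift \<eta>' \<and> \<eta>' \<circ> \<iota> = \<eta>"
proof -
  define E :: "nat \<Rightarrow> 'b set" where "E m = from_nat_into UNIV ` {..m}" for m
  have E: "finite (E m)" for m by (simp add: E_def)
  obtain g where g: "\<And>m. approximates \<beta> \<iota> \<eta> (E m) (g m)"
    using approx[OF E] by metis
  have sup: "\<And>m x y. x \<in> E m \<Longrightarrow> y \<in> E m \<Longrightarrow> g m (sup x y) = sup (g m x) (g m y)"
    and uminus: "\<And>m x. x \<in> E m \<Longrightarrow> g m (- x) = - g m x"
    and shift: "\<And>m x. x \<in> E m \<Longrightarrow> g m (\<beta> x) = shift (g m x)"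
    and nonbot: "\<And>m x. x \<in> E m \<Longrightarrow> x \<noteq> bot \<Longrightarrow> g m x \<noteq> bot"
    and extends: "\<And>m a. \<iota> a \<in> E m \<Longrightarrow> g m (\<iota> a) = \<eta> a"
    using g unfolding approximates_def by simp_all
  define h where "h m x k \<longleftrightarrow> k \<in> rep_pomega_fin (g m x)" for m x k
  \<comment> \<open>The shift condition links times \<open>k\<close> and \<open>Suc k\<close> under
    the same approximation \<open>m\<close>; a change of approximation is handled by
    \<open>s_switch\<close>.\<close>
  define good where "good m k \<longleftrightarrow>
      (\<forall>x\<in>E m. (\<forall>y\<in>E m. h m (sup x y) k = (h m x k \<or> h m y k)) \<and>
        h m (- x) k = (\<not> h m x k) \<and> h m (\<beta> x) (Suc k) = h m x k)" for m k
  have "\<forall>\<^sub>F k in sequentially. good m k" for m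
    unfolding good_def h_def
    by (intro eventually_ball_finite eventually_conj E ballI)
      (simp_all add: sup uminus shift rep_sup_pomega_fin rep_uminus_pomega_fin rep_shift)
  then have "\<exists>K. \<forall>k\<ge>K. good m k" for m by (simp add: eventually_sequentially)
  then obtain K where K: "\<And>m k. K m \<le> k \<Longrightarrow> good m k" by metis
  obtain s where s_ge: "\<And>N. \<forall>\<^sub>F k in sequentially. N \<le> s k"
    and s_K: "\<forall>\<^sub>F k in sequentially. K (s k) \<le> k"
    and s_switch: "\<And>x. \<forall>\<^sub>F k in sequentially. h (s k) x (Suc k) = h (s (Suc k)) x (Suc k)"
    and s_freq: "\<And>x. \<forall>\<^sub>F m in sequentially. \<exists>\<^sub>F k in sequentially. h m x k \<Longrightarrow>
      \<exists>\<^sub>F k in sequentially. h (s k) x k"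
    using splice[OF assms(1), of K h] by blast
  have mem: "\<exists>N. \<forall>m\<ge>N. x \<in> E m" for x
    using from_nat_into_surj[OF assms(1), of x] by (auto simp: E_def)
  have s_mem: "\<forall>\<^sub>F k in sequentially. x \<in> E (s k)" for x
    using mem[of x] s_ge by (metis (mono_tags, lifting) eventually_mono)
  have s_good: "\<forall>\<^sub>F k in sequentially. good (s k) k"
    using s_K by eventually_elim (rule K)
  define \<eta>' where "\<eta>' x = abs_pomega_fin {k. h (s k) x k}" for x
  have rep: "\<forall>\<^sub>F k in sequentially. k \<in> rep_pomega_fin (\<eta>' x) \<longleftrightarrow> h (s k) x k" for x
    using rep_abs_pomega_fin[of "{k. h (s k) x k}"] by (simp add: \<eta>'_def)
  have "boolean_hom \<eta>'"
  proof (rule boolean_homI)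
    show "\<eta>' (sup x y) = sup (\<eta>' x) (\<eta>' y)" for x y
      unfolding eq_pomega_fin_iff
      using rep[of x] rep[of y] rep[of "sup x y"] rep_sup_pomega_fin[of "\<eta>' x" "\<eta>' y"]
        s_mem[of x] s_mem[of y] s_good
      by eventually_elim (auto simp: good_def)
    show "\<eta>' (- x) = - \<eta>' x" for x
      unfolding eq_pomega_fin_iff
      using rep[of x] rep[of "- x"] rep_uminus_pomega_fin[of "\<eta>' x"] s_mem[of x] s_good
      by eventually_elim (auto simp: good_def)
  qed
  moreover have "\<eta>' x \<noteq> bot" if "x \<noteq> bot" for x
  proof -
    have "\<exists>\<^sub>F k in sequentially. h m x k" if "x \<in> E m" for m
      using nonbot[OF that \<open>x \<noteq> bot\<close>] by (simp add: h_def frequently_rep_pomega_fin)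
    then have "\<forall>\<^sub>F m in sequentially. \<exists>\<^sub>F k in sequentially. h m x k"
      using mem[of x] unfolding eventually_sequentially by blast
    then have "\<exists>\<^sub>F k in sequentially. k \<in> rep_pomega_fin (\<eta>' x)"
      using s_freq[of x] rep[of x] by (auto elim: frequently_rev_mp eventually_mono)
    then show ?thesis by (simp add: frequently_rep_pomega_fin)
  qed
  moreover have "\<eta>' (\<beta> x) = shift (\<eta>' x)" for x
  proof -
    have "\<forall>\<^sub>F k in sequentially. Suc k \<in> rep_pomega_fin (\<eta>' (\<beta> x)) \<longleftrightarrow> h (s (Suc k)) (\<beta> x) (Suc k)"
      using rep[of "\<beta> x"] by (subst (asm) eventually_sequentially_Suc[symmetric])
    \<comment> \<open>At time \<open>Suc k\<close>, \<open>s_switch\<close> at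
      \<open>\<beta> x\<close> replaces \<open>s (Suc k)\<close> by \<open>s k\<close>; then
      \<open>good (s k) k\<close> leads back to \<open>x\<close> at time \<open>k\<close>.\<close>
    then have "\<forall>\<^sub>F k in sequentially.
        Suc k \<in> rep_pomega_fin (\<eta>' (\<beta> x)) \<longleftrightarrow> Suc k \<in> rep_pomega_fin (shift (\<eta>' x))"
      using rep[of x] rep_shift[of "\<eta>' x"] s_switch[of "\<beta> x"] s_mem[of x] s_good
      by eventually_elim (auto simp: good_def)
    then show ?thesis
      unfolding eq_pomega_fin_iff by (subst (asm) eventually_sequentially_Suc)
  qed
  moreover have "\<eta>' (\<iota> a) = \<eta> a" for a
    unfolding eq_pomega_fin_iff using rep[of "\<iota> a"] s_mem[of "\<iota> a"]
    by eventually_elim (simp add: h_def extends)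
  ultimately show ?thesis
    using boolean_hom_inj[of \<eta>'] by (intro exI[of _ \<eta>']) (auto simp: embedding_def fun_eq_iff)
qed

section \<open>Necessity of the condition and the equivalence\<close>

text \<open>The extending embedding itself is the digraph isomorphism: it commutes with the
  automorphisms and sends only \<open>bot\<close> to \<open>bot\<close>, so arrows are preserved and
  reflected. Each \<open>\<iota> a\<close> is the join of the members of \<open>B\<close> below it,
  and this join is preserved.\<close>

lemma dagger_if_extends:
  assumes \<eta>': "embedding \<beta> \<gamma> \<eta>'" and \<iota>: "embedding \<alpha> \<beta> \<iota>"
    and A: "is_partition A" and B: "is_partition B" and ref: "refines B (\<iota> ` A)"
  shows "is_partition (\<eta>' ` B) \<and> refines (\<eta>' ` B) ((\<eta>' \<circ> \<iota>) ` A) \<and>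
    digraph_iso_betw B (arrow \<beta>) (\<eta>' ` B) (arrow \<gamma>) \<eta>' \<and>
    (\<forall>a\<in>A. finite_join (\<eta>' ` {b \<in> B. b \<le> \<iota> a}) = (\<eta>' \<circ> \<iota>) a)"
proof (intro conjI ballI)
  have hom: "boolean_hom \<eta>'" and inj: "inj \<eta>'" using \<eta>' by (auto simp: embedding_def)
  show "is_partition (\<eta>' ` B)" by (rule is_partition_image[OF \<eta>' B])
  show "refines (\<eta>' ` B) ((\<eta>' \<circ> \<iota>) ` A)"
    using ref boolean_hom_mono[OF hom] by (fastforce simp: refines_def)
  have "arrow \<gamma> (\<eta>' x) (\<eta>' y) = arrow \<beta> x y" for x y
    using embedding_eq_bot_iff[OF \<eta>', of "inf (\<beta> x) y"]
    by (simp add: arrow_def boolean_hom_inf[OF hom] embedding_commute[OF \<eta>'])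
  then show "digraph_iso_betw B (arrow \<beta>) (\<eta>' ` B) (arrow \<gamma>) \<eta>'"
    using inj by (auto simp: digraph_iso_betw_def intro: inj_on_imp_bij_betw inj_on_subset)
  fix a assume "a \<in> A"
  then have "decided B (\<iota> a)"
    using refining_partition_decides[OF is_partition_image[OF \<iota> A] ref] by blast
  from join_below_decided[OF B this]
  show "finite_join (\<eta>' ` {b \<in> B. b \<le> \<iota> a}) = (\<eta>' \<circ> \<iota>) a"
    using boolean_hom_finite_join[OF hom, of "{b \<in> B. b \<le> \<iota> a}"] is_partition_finite[OF B] by simp
qed

theorem theorem8p8:
  fixes \<alpha> :: "'a::boolean_algebra \<Rightarrow> 'a"
    and \<beta> :: "'b::boolean_algebra \<Rightarrow> 'b"
    and \<iota> :: "'a \<Rightarrow> 'b"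
    and \<eta> :: "'a \<Rightarrow> pomega_fin"
  assumes "countable (UNIV :: 'a set)" and "dynamical_system \<alpha>" and "incompressible \<alpha>"
    and "countable (UNIV :: 'b set)" and "dynamical_system \<beta>" and "incompressible \<beta>"
    and "embedding \<alpha> \<beta> \<iota>"
    and "embedding \<alpha> shift \<eta>"
  shows "(\<exists>\<eta>'. embedding \<beta> shift \<eta>' \<and> \<eta>' \<circ> \<iota> = \<eta>) \<longleftrightarrow>
    (\<forall>A B. is_partition A \<and> is_partition B \<and> refines B (\<iota> ` A) \<longrightarrow>
      (\<exists>C \<tau>. is_partition C \<and> refines C (\<eta> ` A) \<and>
        digraph_iso_betw B (arrow \<beta>) C (arrow shift) \<tau> \<and>
        (\<forall>a\<in>A. finite_join (\<tau> ` {b \<in> B. b \<le> \<iota> a}) = \<eta> a)))"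
    (is "?extends \<longleftrightarrow> ?dagger")
proof
  assume ?extends
  then obtain \<eta>' where "embedding \<beta> shift \<eta>'" "\<eta>' \<circ> \<iota> = \<eta>" by blast
  then show ?dagger using dagger_if_extends[OF _ assms(7)] by blast
next
  assume dagger: ?dagger
  show ?extends
  proof (rule embedding_extends_if_approximable[OF assms(4)])
    fix E :: "'b set" assume "finite E"
    then show "\<exists>g. approximates \<beta> \<iota> \<eta> E g"
      by (intro finite_approximation[OF assms(5,7,8)]) (use dagger in blast)
  qed
qed

end
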